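(* Let $m>1$. Assume: (1) $\mathcal{A}$ is irreducible; (2) the noise vectors $(\varepsilon_{k,1},\ldots,\varepsilon_{k,n})^{\tau}$, $k\ge 0$, are mutually independent, and for each $i=1,\ldots,n$, $E\varepsilon_{k,i}=0$ for all $k\geq 0$ and $\sup_{k\geq 1}E\varepsilon_{k,i}^2<M$, where $M>0$ is a constant. If $\|E\widetilde\Theta_{0}\|\neq 0$, then there is a sequence of data $\{\Phi_{k}\}_{k=0}^{+\infty}$, $\Phi_k=\mathrm{diag}\{\phi_{k,1},\dots,\phi_{k,n}\}$ with $\phi_{k,i}\in\mathbb{R}^m$, satisfying $$\lim_{k\rightarrow+\infty}\lambda_{\min}(P_{k,i}^{-1})=+\infty,\quad i=1,\ldots,n,$$ such that the diffusion recursive least squares algorithm run with these data satisfies $$\sup_{k\geq 0}E\|\widetilde\Theta_{k}\|^2=+\infty.$$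
   Context: Model: there are $n$ nodes and an unknown deterministic parameter $\theta\in\mathbb{R}^m$. At time $k\ge 0$ node $i\in\{1,\dots,n\}$ observes $\phi_{k,i}\in\mathbb{R}^m$ and $y_{k,i}=\theta^{\tau}\phi_{k,i}+\varepsilon_{k,i}\in\mathbb{R}$, where $\varepsilon_{k,i}$ is scalar noise and $(\cdot)^\tau$ denotes transpose. $\mathcal{A}=(a_{ij})_{n\times n}$ is the nonnegative weighted adjacency matrix of a directed graph on $\{1,\dots,n\}$ with edge set $\mathcal E$: $a_{ij}>0$ if $(i,j)\in\mathcal E$ and $a_{ij}=0$ otherwise. Diffusion recursive least squares (RLS), adapt-then-combine form: with initial estimates $\theta_{0,i}\in\mathbb{R}^m$ and $P_{0,i}=I_m$, for $k\ge 0$, $$P_{k+1,i}^{-1}=I_m+\sum_{j=0}^{k}\phi_{j,i}\phi_{j,i}^{\tau},\qquad L_{k,i}=P_{k+1,i}\phi_{k,i}=\frac{P_{k,i}\phi_{k,i}}{1+\phi_{k,i}^{\tau}P_{k,i}\phi_{k,i}},$$ $$\beta_{k+1,i}=\theta_{k,i}+L_{k,i}(y_{k,i}-\theta_{k,i}^{\tau}\phi_{k,i}),\qquad \theta_{k+1,i}=\sum_{j=1}^{n}a_{ij}\beta_{k+1,j}.$$ Notation: $\widetilde\Theta_k=\mathrm{col}\{\theta_{k,1}-\theta,\dots,\theta_{k,n}-\theta\}\in\mathbb{R}^{mn}$; $\Phi_k$ is the block-diagonal $mn\times n$ matrix with diagonal blocks $\phi_{k,i}$; $\lambda_{\min}$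 is the smallest eigenvalue; $\|\cdot\|$ is the Euclidean norm.
   Formalization: The formal theorem assumes in addition that there are at least two nodes (n > 1); for n = 1 with A = (1) the claim fails, since ordinary RLS with deterministic initial error and bounded noise variance has bounded mean-square error. *)

theory Defs
  imports "HOL-Probability.Probability"
begin

definition weighted_adjacency :: "('n \<times> 'n) set \<Rightarrow> real^'n^'n \<Rightarrow> bool" where
  "weighted_adjacency E A \<longleftrightarrow>
     (\<forall>i j. (if (i, j) \<in> E then A $ i $ j > 0 else A $ i $ j = 0))"

text \<open>
  A square matrix is reducible if a simultaneous permutation of its rows and columns brings it
  into block upper triangular form with a zero lower left block of size
  \<open>(n - r) \<times> r\<close>, \<open>1 \<le> r < n\<close>.  As the index type carries no order,
  the permutation is an enumeration \<open>\<pi>\<close> of the indices by \<open>{..<n}\<close>.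
  Every 1-by-1 matrix, zero included, is irreducible in this sense.
\<close>

definition reducible_matrix :: "'a::zero^'n^'n \<Rightarrow> bool" where
  "reducible_matrix A \<longleftrightarrow>
     (\<exists>(\<pi> :: nat \<Rightarrow> 'n) r. bij_betw \<pi> {..<CARD('n)} UNIV \<and> 1 \<le> r \<and> r < CARD('n) \<and>
        (\<forall>i\<in>{r..<CARD('n)}. \<forall>j\<in>{..<r}. A $ \<pi> i $ \<pi> j = 0))"

abbreviation irreducible_matrix :: "'a::zero^'n^'n \<Rightarrow> bool" where
  "irreducible_matrix A \<equiv> \<not> reducible_matrix A"

definition eigenvalues :: "real^'m^'m \<Rightarrow> real set" where
  "eigenvalues S = {c. \<exists>v. v \<noteq> 0 \<and> S *v v = c *\<^sub>R v}"

text \<open>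
  Used only for symmetric matrices, whose set of real eigenvalues is finite and nonempty;
  otherwise \<open>Min\<close> may be unspecified.
\<close>

definition lambda_min :: "real^'m^'m \<Rightarrow> real" where
  "lambda_min S = Min (eigenvalues S)"

definition outer_product :: "real^'m \<Rightarrow> real^'m^'m" where
  "outer_product v = (\<chi> a b. v $ a * v $ b)"

text \<open>
  The data \<open>\<phi> k i\<close> are the diagonal blocks of \<open>\<Phi>\<^sub>k\<close>.
  For \<open>k = 0\<close> the sum is empty and \<open>rls_P \<phi> 0 i\<close> is the identity.
\<close>

definition rls_P :: "(nat \<Rightarrow> 'n \<Rightarrow> real^'m) \<Rightarrow> nat \<Rightarrow> 'n \<Rightarrow> real^'m^'m" where
  "rls_P \<phi> k i = matrix_inv (mat 1 + (\<Sum>j<k. outer_product (\<phi> j i)))"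

definition rls_gain :: "(nat \<Rightarrow> 'n \<Rightarrow> real^'m) \<Rightarrow> nat \<Rightarrow> 'n \<Rightarrow> real^'m" where
  "rls_gain \<phi> k i = rls_P \<phi> (Suc k) i *v \<phi> k i"

definition rls_adapt ::
    "(nat \<Rightarrow> 'n \<Rightarrow> real^'m) \<Rightarrow> (nat \<Rightarrow> 'n \<Rightarrow> real) \<Rightarrow> nat \<Rightarrow> 'n \<Rightarrow> real^'m \<Rightarrow> real^'m" where
  "rls_adapt \<phi> y k i t = t + (y k i - t \<bullet> \<phi> k i) *\<^sub>R rls_gain \<phi> k i"

primrec diffusion_rls ::
    "real^'n^'n \<Rightarrow> (nat \<Rightarrow> 'n \<Rightarrow> real^'m) \<Rightarrow> (nat \<Rightarrow> 'n \<Rightarrow> real) \<Rightarrow> ('n \<Rightarrow> real^'m)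
      \<Rightarrow> nat \<Rightarrow> 'n \<Rightarrow> real^'m" where
  "diffusion_rls A \<phi> y \<theta>\<^sub>0 0 = \<theta>\<^sub>0"
| "diffusion_rls A \<phi> y \<theta>\<^sub>0 (Suc k) =
     (\<lambda>i. \<Sum>j\<in>UNIV. A $ i $ j *\<^sub>R rls_adapt \<phi> y k j (diffusion_rls A \<phi> y \<theta>\<^sub>0 k j))"

definition observation ::
    "real^'m \<Rightarrow> (nat \<Rightarrow> 'n \<Rightarrow> real^'m) \<Rightarrow> (nat \<Rightarrow> 'w \<Rightarrow> real^'n) \<Rightarrow> 'w \<Rightarrow> nat \<Rightarrow> 'n \<Rightarrow> real" where
  "observation \<theta> \<phi> \<epsilon> \<omega> k i = \<theta> \<bullet> \<phi> k i + \<epsilon> k \<omega> $ i"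

text \<open>
  The stacked error \<open>col{\<theta>\<^bsub>k,i\<^esub> - \<theta>}\<close> is an element of \<open>real^'m^'n\<close>,
  whose norm is the Euclidean norm of the concatenation of its blocks.
\<close>

definition estimation_error ::
    "real^'n^'n \<Rightarrow> real^'m \<Rightarrow> (nat \<Rightarrow> 'n \<Rightarrow> real^'m) \<Rightarrow> (nat \<Rightarrow> 'w \<Rightarrow> real^'n)
      \<Rightarrow> ('n \<Rightarrow> 'w \<Rightarrow> real^'m) \<Rightarrow> nat \<Rightarrow> 'w \<Rightarrow> real^'m^'n" where
  "estimation_error A \<theta> \<phi> \<epsilon> \<theta>\<^sub>0 k \<omega> =
     (\<chi> i. diffusion_rls A \<phi> (observation \<theta> \<phi> \<epsilon> \<omega>) (\<lambda>i. \<theta>\<^sub>0 i \<omega>) k i - \<theta>)"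

end

theory Submission
  imports Defs "HOL-Real_Asymp.Real_Asymp"
begin

text \<open>
  Taking expectations in the recursion shows that the mean error is the error of the noise-free run
  started at the mean initial estimates, and \<open>1 + E \<bar>X\<bar>\<^sup>2\<close> dominates \<open>\<bar>E X\<bar>\<close>.  So it suffices to find data
  that excite every node in every direction while the noise-free error is unbounded.

  Such data are built in stages from any nonzero error.  First every node is fed regressors close to
  large multiples of the basis vectors, perturbed so that the error does not become zero.  Then two
  steps make the error large.  Since \<open>A\<close> is irreducible, a node with nonzero error influences another node
  \<open>j\<close>, and a perturbation of its regressor ensures that the part \<open>y\<close> of the next error of \<open>j\<close> that does not
  come from \<open>j\<close> itself is nonzero.  Node \<open>j\<close> receives the regressor \<open>T y\<close>, after which its gain matrix
  is nearly singular in the direction \<open>y\<close>, although mixing has put the error \<open>y\<close> back there.  The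
  regressor \<open>T y + w\<close> with \<open>w\<close> orthogonal to \<open>P y\<close> then turns this into an error of order \<open>T\<close>.
\<close>

section \<open>Self-adjoint matrices and the smallest eigenvalue\<close>

definition self_adjoint :: "real^'m^'m \<Rightarrow> bool" where
  "self_adjoint S \<longleftrightarrow> (\<forall>u v. u \<bullet> (S *v v) = (S *v u) \<bullet> v)"

definition spd :: "real^'m^'m \<Rightarrow> bool" where
  "spd S \<longleftrightarrow> self_adjoint S \<and> (\<forall>v. v \<noteq> 0 \<longrightarrow> 0 < v \<bullet> (S *v v))"

text \<open>Eigenvectors of different eigenvalues are orthogonal, hence independent, so there are
  finitely many. This and nonemptiness make \<open>Min\<close> in \<open>lambda_min\<close> a true
  minimum.\<close>

lemma finite_eigenvalues:
  fixes S :: "real^'m^'m"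
  assumes "self_adjoint S"
  shows "finite (eigenvalues S)"
proof -
  have "\<forall>c\<in>eigenvalues S. \<exists>v. v \<noteq> 0 \<and> S *v v = c *\<^sub>R v"
    by (simp add: eigenvalues_def)
  then obtain f where f: "\<And>c. c \<in> eigenvalues S \<Longrightarrow> f c \<noteq> 0 \<and> S *v f c = c *\<^sub>R f c"
    by (metis (mono_tags, lifting))
  have orth: "orthogonal (f c) (f d)" if "c \<in> eigenvalues S" "d \<in> eigenvalues S" "c \<noteq> d" for c d
  proof -
    have "f c \<bullet> (S *v f d) = (S *v f c) \<bullet> f d"
      using assms by (simp add: self_adjoint_def)
    then have "d * (f c \<bullet> f d) = c * (f c \<bullet> f d)"
      using f that by simp
    then show ?thesis
      using that by (simp add: orthogonal_def)
  qed
  have inj: "inj_on f (eigenvalues S)"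
    by (rule inj_onI) (metis f orth orthogonal_self)
  have "pairwise orthogonal (f ` eigenvalues S)"
    by (auto simp: pairwise_def intro: orth)
  then have "independent (f ` eigenvalues S)"
    by (rule pairwise_orthogonal_independent) (use f in auto)
  then show ?thesis
    using inj finite_imageD independent_imp_finite by blast
qed

text \<open>The minimum of the Rayleigh quotient over the unit sphere is an eigenvalue.\<close>

lemma eigenvalues_nonempty:
  fixes S :: "real^'m^'m"
  assumes "self_adjoint S"
  shows "eigenvalues S \<noteq> {}"
proof -
  let ?q = "\<lambda>v. v \<bullet> (S *v v)"
  have "continuous_on (sphere 0 1) ?q"
    by (intro continuous_intros linear_continuous_on) simp
  moreover have "sphere (0::real^'m) 1 \<noteq> {}"
    by simp
  ultimately obtain v where v: "norm v = 1" and min: "\<And>u. norm u = 1 \<Longrightarrow> ?q v \<le> ?q u"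
    using continuous_attains_inf[of "sphere (0::real^'m) 1" ?q] by auto
  define c where "c = ?q v"
  \<comment> \<open>Shifting \<open>S\<close> by the minimum c makes \<open>T\<close> positive
    semidefinite while its form vanishes at v, which forces T v = 0.\<close>
  define T where "T u = S *v u - c *\<^sub>R u" for u
  have Tadd: "T (x + t *\<^sub>R y) = T x + t *\<^sub>R T y" for x y t
    by (simp add: T_def matrix_vector_right_distrib matrix_vector_mult_scaleR algebra_simps)
  have Tsym: "x \<bullet> T y = T x \<bullet> y" for x y
    using assms by (simp add: T_def inner_diff inner_commute self_adjoint_def)
  have Tpos: "0 \<le> u \<bullet> T u" for u
  proof (cases "u = 0")
    case False
    have "c \<le> ?q ((1 / norm u) *\<^sub>R u)"
      unfolding c_def by (rule min) (use False in simp)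
    then have "c \<le> ?q u / (norm u)\<^sup>2"
      by (simp add: matrix_vector_mult_scaleR power2_eq_square)
    then have "c * (norm u)\<^sup>2 \<le> ?q u"
      using False by (simp add: field_simps)
    then show ?thesis
      by (simp add: T_def inner_diff_right power2_norm_eq_inner)
  qed (simp add: T_def)
  have vTv: "v \<bullet> T v = 0"
    using v by (simp add: T_def c_def inner_diff_right flip: power2_norm_eq_inner)
  have "T v = 0"
  proof (rule ccontr)
    assume "T v \<noteq> 0"
    define a where "a = T v \<bullet> T v"
    define b where "b = T v \<bullet> T (T v)"
    have a: "a > 0" and b: "b \<ge> 0"
      using \<open>T v \<noteq> 0\<close> Tpos by (auto simp: a_def b_def)
    \<comment> \<open>At v + t T v the form of \<open>T\<close> is 2 t a + t^2 b, which is negative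
      for this t. The summand 1 covers the case b = 0.\<close>
    define t where "t = - a / (b + 1)"
    have "0 \<le> (v + t *\<^sub>R T v) \<bullet> T (v + t *\<^sub>R T v)"
      by (rule Tpos)
    also have "\<dots> = 2 * t * a + t\<^sup>2 * b"
      using vTv by (simp add: Tadd inner_add_left inner_add_right Tsym[of v "T v"] a_def b_def
          power2_eq_square algebra_simps)
    also have "\<dots> = - (a\<^sup>2 * (b + 2) / (b + 1)\<^sup>2)"
      using b by (simp add: t_def divide_simps) (simp add: algebra_simps power2_eq_square)
    also have "\<dots> < 0"
      using a b by simp
    finally show False by simp
  qed
  then have "c \<in> eigenvalues S"
    unfolding eigenvalues_def T_def using v by (auto intro!: exI[of _ v])
  then show ?thesis by blast
qed

lemma lambda_min_ge:
  assumes "self_adjoint S" and "\<And>v. c * (v \<bullet> v) \<le> v \<bullet> (S *v v)"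
  shows "c \<le> lambda_min S"
proof -
  have "c \<le> d" if d: "d \<in> eigenvalues S" for d
  proof -
    from d obtain v where "v \<noteq> 0" "S *v v = d *\<^sub>R v"
      by (auto simp: eigenvalues_def)
    then show ?thesis
      using assms(2)[of v] by simp
  qed
  then show ?thesis
    unfolding lambda_min_def
    using assms(1) by (subst Min_ge_iff) (auto simp: finite_eigenvalues eigenvalues_nonempty)
qed

section \<open>Information matrices and their inverses\<close>

lemma outer_product_mult: "outer_product u *v v = (u \<bullet> v) *\<^sub>R u"
  by (simp add: vec_eq_iff outer_product_def matrix_vector_mult_def inner_vec_def sum_distrib_left
      mult_ac)

text \<open>The inverse of \<open>rls_P\<close>, kept as an object of its own because its quadratic
  form is an explicit sum of squares, on which excitation is measured.\<close>

definition information :: "(nat \<Rightarrow> 'n \<Rightarrow> real^'m) \<Rightarrow> nat \<Rightarrow> 'n \<Rightarrow> real^'m^'m" where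
  "information \<phi> k i = mat 1 + (\<Sum>j<k. outer_product (\<phi> j i))"

lemma sum_matrix_vector_mult: "(\<Sum>j\<in>I. B j) *v v = (\<Sum>j\<in>I. B j *v v)"
  for B :: "'i \<Rightarrow> real^'m^'n"
  by (induction I rule: infinite_finite_induct) (auto simp: matrix_vector_mult_add_rdistrib)

lemma information_mult: "information \<phi> k i *v v = v + (\<Sum>j<k. (\<phi> j i \<bullet> v) *\<^sub>R \<phi> j i)"
  by (simp add: information_def matrix_vector_mult_add_rdistrib sum_matrix_vector_mult
      outer_product_mult)

lemma information_form:
  "v \<bullet> (information \<phi> k i *v v) = v \<bullet> v + (\<Sum>j<k. (\<phi> j i \<bullet> v)\<^sup>2)"
  by (simp add: information_mult inner_add_right inner_sum_right power2_eq_square inner_commute)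

lemma self_adjoint_information: "self_adjoint (information \<phi> k i)"
  unfolding self_adjoint_def
  by (simp add: information_mult inner_add inner_sum_right inner_sum_left inner_commute mult_ac)

lemma spd_information: "spd (information \<phi> k i)"
  unfolding spd_def
  by (auto simp: self_adjoint_information information_form intro!: add_pos_nonneg sum_nonneg)

lemma
  fixes S :: "real^'m^'m"
  assumes "spd S"
  shows matrix_inv_mult_spd: "matrix_inv S *v (S *v v) = v"
    and mult_matrix_inv_spd: "S *v (matrix_inv S *v v) = v"
    and matrix_inv_matrix_inv_spd: "matrix_inv (matrix_inv S) = S"
    and spd_matrix_inv: "spd (matrix_inv S)"
proof -
  \<comment> \<open>Positivity makes the kernel trivial, so a two-sided inverse exists and the
    choice in \<open>matrix_inv\<close> returns one.\<close>
  have "\<forall>v. S *v v = 0 \<longrightarrow> v = 0"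
    using assms unfolding spd_def by (metis inner_zero_right less_irrefl)
  then have "\<exists>B. B ** S = mat 1"
    by (simp add: matrix_left_invertible_ker)
  then have "\<exists>B. S ** B = mat 1 \<and> B ** S = mat 1"
    using matrix_left_right_inverse by blast
  then have *: "S ** matrix_inv S = mat 1" "matrix_inv S ** S = mat 1"
    unfolding matrix_inv_def by (metis (mono_tags, lifting) someI_ex)+
  show 1: "matrix_inv S *v (S *v v) = v" "S *v (matrix_inv S *v v) = v" for v
    by (simp_all add: matrix_vector_mul_assoc *)
  show "matrix_inv (matrix_inv S) = S"
    unfolding matrix_inv_def[of "matrix_inv S"]
  proof (rule some_equality)
    fix B assume "matrix_inv S ** B = mat 1 \<and> B ** matrix_inv S = mat 1"
    then show "B = S"
      by (metis * matrix_mul_assoc matrix_mul_lid matrix_mul_rid)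
  qed (use * in auto)
  show "spd (matrix_inv S)"
    unfolding spd_def self_adjoint_def
  proof (intro conjI allI impI)
    fix u v
    show "u \<bullet> (matrix_inv S *v v) = (matrix_inv S *v u) \<bullet> v"
      using assms unfolding spd_def self_adjoint_def by (metis 1(2))
  next
    fix v :: "real^'m" assume "v \<noteq> 0"
    then have "matrix_inv S *v v \<noteq> 0"
      by (metis 1(2) matrix_vector_mult_0_right)
    then show "0 < v \<bullet> (matrix_inv S *v v)"
      using assms unfolding spd_def by (metis 1(2) inner_commute)
  qed
qed

lemma rls_P_eq: "rls_P \<phi> k i = matrix_inv (information \<phi> k i)"
  by (simp add: rls_P_def information_def)

lemma spd_rls_P: "spd (rls_P \<phi> k i)"
  by (simp add: rls_P_eq spd_matrix_inv spd_information)

lemma spd_nonneg: "spd S \<Longrightarrow> 0 \<le> v \<bullet> (S *v v)"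
  unfolding spd_def by (cases "v = 0") (auto intro: less_imp_le)

section \<open>Rank one updates of the gain matrix and of the error\<close>

text \<open>The new information matrix maps the right-hand side to u, so that side is its inverse
  applied to u.\<close>

lemma rls_P_Suc_Sherman_Morrison:
  fixes \<phi> :: "nat \<Rightarrow> 'n \<Rightarrow> real^'m" and k i
  defines "P \<equiv> rls_P \<phi> k i" and "f \<equiv> \<phi> k i"
  shows "rls_P \<phi> (Suc k) i *v u = P *v u - ((f \<bullet> (P *v u)) / (1 + f \<bullet> (P *v f))) *\<^sub>R (P *v f)"
    (is "_ = ?r")
proof -
  let ?N = "information \<phi> k i" and ?N' = "information \<phi> (Suc k) i"
  have N': "?N' *v v = ?N *v v + (f \<bullet> v) *\<^sub>R f" for v
    by (simp add: information_mult f_def)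
  have NP: "?N *v (P *v v) = v" for v
    by (simp add: P_def rls_P_eq mult_matrix_inv_spd spd_information)
  define c where "c = (f \<bullet> (P *v u)) / (1 + f \<bullet> (P *v f))"
  have "0 \<le> f \<bullet> (P *v f)"
    unfolding P_def by (rule spd_nonneg[OF spd_rls_P])
  then have c: "f \<bullet> (P *v u) = c * (1 + f \<bullet> (P *v f))"
    by (simp add: c_def)
  have "?N' *v ?r = u - c *\<^sub>R f + (f \<bullet> (P *v u) - c * (f \<bullet> (P *v f))) *\<^sub>R f"
    by (simp add: N' NP matrix_vector_mult_diff_distrib matrix_vector_mult_scaleR inner_diff_right
        algebra_simps flip: c_def)
  also have "\<dots> = u"
    by (simp add: c algebra_simps)
  finally have "?N' *v ?r = u" .
  then show ?thesis
    by (metis matrix_inv_mult_spd rls_P_eq spd_information)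
qed

text \<open>The effect of one recursive least squares update, without noise, on the estimation error.\<close>

definition rls_correct :: "real^'m^'m \<Rightarrow> real^'m \<Rightarrow> real^'m \<Rightarrow> real^'m" where
  "rls_correct P f x = x - ((x \<bullet> f) / (1 + f \<bullet> (P *v f))) *\<^sub>R (P *v f)"

lemma rls_gain_eq:
  "rls_gain \<phi> k i = (1 / (1 + \<phi> k i \<bullet> (rls_P \<phi> k i *v \<phi> k i))) *\<^sub>R (rls_P \<phi> k i *v \<phi> k i)"
proof -
  define q where "q = \<phi> k i \<bullet> (rls_P \<phi> k i *v \<phi> k i)"
  have q: "0 \<le> q"
    unfolding q_def by (rule spd_nonneg[OF spd_rls_P])
  have "rls_gain \<phi> k i = (1 - q / (1 + q)) *\<^sub>R (rls_P \<phi> k i *v \<phi> k i)"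
    by (simp add: rls_gain_def rls_P_Suc_Sherman_Morrison scaleR_diff_left flip: q_def)
  also have "1 - q / (1 + q) = 1 / (1 + q)"
    using q by (simp add: field_simps)
  finally show ?thesis
    by (simp add: q_def)
qed

text \<open>If x is not orthogonal to f, the correction along the ray r f is a fixed nonzero vector
  times r^2 / (1 + r^2 q), which is injective for r > 0. Of two different outcomes at most one can
  lead to a zero error, so one of them is usable.\<close>

lemma rls_correct_nonconstant:
  fixes x g :: "real^'m"
  assumes "spd P" and "x \<noteq> 0"
  shows "\<exists>f f'. norm (f - g) \<le> 1 \<and> norm (f' - g) \<le> 1 \<and> rls_correct P f x \<noteq> rls_correct P f' x"
proof -
  \<comment> \<open>Only a g orthogonal to x has to be moved. The shift by \<open>\<delta>\<close>
    and the later scaling by 1 + t each cost a distance of at most 1/2.\<close>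
  define \<delta> where "\<delta> = 1 / (2 * norm x)"
  define f where "f = g + (if g \<bullet> x = 0 then \<delta> else 0) *\<^sub>R x"
  have \<delta>: "\<delta> > 0"
    using assms by (simp add: \<delta>_def)
  have nf: "norm (f - g) \<le> 1 / 2"
    using assms by (simp add: f_def \<delta>_def)
  have fx: "x \<bullet> f \<noteq> 0"
    using \<delta> assms by (auto simp: f_def inner_commute inner_add_right)
  define t where "t = 1 / (2 * norm f)"
  have f0: "f \<noteq> 0"
    using fx by auto
  then have t: "t > 0"
    by (simp add: t_def)
  define f' where "f' = (1 + t) *\<^sub>R f"
  have "f' - g = (f - g) + t *\<^sub>R f"
    by (simp add: f'_def algebra_simps)
  then have "norm (f' - g) \<le> norm (f - g) + norm (t *\<^sub>R f)"
    by (metis norm_triangle_ineq)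
  then have nf': "norm (f' - g) \<le> 1"
    using nf f0 by (simp add: t_def)
  define p where "p = P *v f"
  define q where "q = f \<bullet> p"
  have q: "q > 0"
    using assms(1) f0 by (simp add: spd_def p_def q_def)
  then have p0: "p \<noteq> 0"
    by (auto simp: q_def)
  have "rls_correct P f x \<noteq> rls_correct P f' x"
  proof
    assume "rls_correct P f x = rls_correct P f' x"
    moreover have "rls_correct P f x = x - ((x \<bullet> f) / (1 + q)) *\<^sub>R p"
      by (simp add: rls_correct_def p_def q_def)
    moreover have "rls_correct P f' x = x - ((x \<bullet> f) * ((1 + t)\<^sup>2 / (1 + (1 + t)\<^sup>2 * q))) *\<^sub>R p"
      by (simp add: rls_correct_def p_def q_def f'_def matrix_vector_mult_scaleR power2_eq_square
          mult_ac)
    ultimately have "(x \<bullet> f) / (1 + q) = (x \<bullet> f) * ((1 + t)\<^sup>2 / (1 + (1 + t)\<^sup>2 * q))"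
      using p0 by simp
    then have "1 / (1 + q) = (1 + t)\<^sup>2 / (1 + (1 + t)\<^sup>2 * q)"
      using fx by (metis mult_cancel_left times_divide_eq_right mult.right_neutral)
    moreover have "1 + q > 0" "1 + (1 + t)\<^sup>2 * q > 0"
      using q by (auto intro!: add_pos_nonneg)
    ultimately have "1 + (1 + t)\<^sup>2 * q = (1 + t)\<^sup>2 * (1 + q)"
      by (simp add: frac_eq_eq)
    then have "(1 + t)\<^sup>2 = 1"
      by (simp add: algebra_simps)
    then show False
      using t by (simp add: power2_eq_1_iff)
  qed
  then show ?thesis
    using nf nf' by (intro exI[of _ f] exI[of _ f']) auto
qed

text \<open>The factor T^2 / (1 + T^2 q) tends to 1 / q, so the first large regressor alone leaves
  the error bounded.\<close>

lemma rls_correct_tendsto: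
  assumes "spd P" and "y \<noteq> 0"
  shows "((\<lambda>T. rls_correct P (T *\<^sub>R y) x) \<longlongrightarrow> x - ((x \<bullet> y) / (y \<bullet> (P *v y))) *\<^sub>R (P *v y)) at_top"
proof -
  define q where "q = y \<bullet> (P *v y)"
  have q: "q > 0"
    using assms by (simp add: spd_def q_def)
  have "((\<lambda>T. T\<^sup>2 / (1 + T\<^sup>2 * q)) \<longlongrightarrow> 1 / q) at_top"
    using q by (real_asymp simp: field_simps)
  then have "((\<lambda>T. x - ((x \<bullet> y) * (T\<^sup>2 / (1 + T\<^sup>2 * q))) *\<^sub>R (P *v y))
      \<longlongrightarrow> x - ((x \<bullet> y) * (1 / q)) *\<^sub>R (P *v y)) at_top"
    by (intro tendsto_diff tendsto_const tendsto_scaleR tendsto_mult)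
  moreover have "rls_correct P (T *\<^sub>R y) x = x - ((x \<bullet> y) * (T\<^sup>2 / (1 + T\<^sup>2 * q))) *\<^sub>R (P *v y)" for T
    by (simp add: rls_correct_def matrix_vector_mult_scaleR q_def power2_eq_square mult_ac)
  ultimately show ?thesis
    by (simp add: q_def)
qed

text \<open>
  After the regressor \<open>T y\<close> the matrix \<open>P' T\<close> is of order \<open>T\<^sup>-\<^sup>2\<close> in the direction \<open>y\<close>
  but not in the direction \<open>w\<close>.  The regressor \<open>T y + w\<close> then has a prediction error of order
  \<open>T\<close>, which is charged to the direction \<open>w\<close> with a gain bounded away from zero.
\<close>

lemma rls_correct_blow_up:
  fixes P' :: "real \<Rightarrow> real^'m^'m"
  assumes P: "spd P" and y: "y \<noteq> 0" and w: "w \<noteq> 0" "w \<bullet> (P *v y) = 0"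
    and P': "\<And>T u. P' T *v u = P *v u -
      (((T *\<^sub>R y) \<bullet> (P *v u)) / (1 + (T *\<^sub>R y) \<bullet> (P *v (T *\<^sub>R y)))) *\<^sub>R (P *v (T *\<^sub>R y))"
  shows "LIM T at_top. w \<bullet> rls_correct (P' T) (T *\<^sub>R y + w) (y + a *\<^sub>R rls_correct P (T *\<^sub>R y) x) :> at_bot"
proof -
  define p q \<omega> s N c where "p = P *v y" and "q = y \<bullet> p" and "\<omega> = w \<bullet> (P *v w)"
    and "s = x \<bullet> y" and "N = y \<bullet> y" and "c = w \<bullet> y + a * (w \<bullet> x)"
  have pos: "q > 0" "\<omega> > 0" "N > 0"
    using P y w by (auto simp: spd_def q_def p_def \<omega>_def N_def)
  have wp: "w \<bullet> p = 0"
    using w by (simp add: p_def)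
  have yPw: "y \<bullet> (P *v w) = 0"
    using P w unfolding spd_def self_adjoint_def by (metis inner_commute)
  have q1: "1 + T\<^sup>2 * q > 0" for T
    using pos by (intro add_pos_nonneg) auto
  \<comment> \<open>As y is orthogonal to P w, the update keeps P w, while the coefficient of p
    drops from T to order 1 / T.\<close>
  have Pd: "P' T *v (T *\<^sub>R y + w) = P *v w + (T / (1 + T\<^sup>2 * q)) *\<^sub>R p" for T
  proof -
    have "P' T *v (T *\<^sub>R y + w) = P *v w + (T - T ^ 3 * q / (1 + T\<^sup>2 * q)) *\<^sub>R p"
      by (simp add: P' matrix_vector_right_distrib matrix_vector_mult_scaleR inner_add_right yPw
          algebra_simps power2_eq_square power3_eq_cube flip: p_def q_def)
    also have "T - T ^ 3 * q / (1 + T\<^sup>2 * q) = T / (1 + T\<^sup>2 * q)"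
      using q1[of T] by (simp add: field_simps power2_eq_square power3_eq_cube)
    finally show ?thesis .
  qed
  define D where "D T = 1 + (T\<^sup>2 * q / (1 + T\<^sup>2 * q) + \<omega>)" for T
  have D: "1 + (T *\<^sub>R y + w) \<bullet> (P' T *v (T *\<^sub>R y + w)) = D T" for T
    unfolding Pd D_def
    by (simp add: inner_add_left inner_add_right wp yPw power2_eq_square flip: q_def \<omega>_def)
  define X where "X T = y + a *\<^sub>R rls_correct P (T *\<^sub>R y) x" for T
  have X: "X T = y + a *\<^sub>R (x - (T\<^sup>2 * s / (1 + T\<^sup>2 * q)) *\<^sub>R p)" for T
    by (simp add: X_def rls_correct_def matrix_vector_mult_scaleR power2_eq_square mult_ac s_def
        flip: p_def q_def)
  have wX: "w \<bullet> X T = c" for T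
    by (simp add: X inner_add_right inner_diff_right wp c_def)
  \<comment> \<open>The part from x fades, but the y that mixing has put back leaves N > 0, so the
    prediction error grows like T N.\<close>
  have yX: "y \<bullet> X T = N + a * s / (1 + T\<^sup>2 * q)" for T
  proof -
    have "y \<bullet> X T = N + a * (s - T\<^sup>2 * s / (1 + T\<^sup>2 * q) * q)"
      by (simp add: X inner_add_right inner_diff_right N_def s_def q_def inner_commute[of y x])
    also have "s - T\<^sup>2 * s / (1 + T\<^sup>2 * q) * q = s / (1 + T\<^sup>2 * q)"
      using q1[of T] by (simp add: field_simps)
    finally show ?thesis by simp
  qed
  have "w \<bullet> rls_correct (P' T) (T *\<^sub>R y + w) (X T)
      = c - (T * (N + a * s / (1 + T\<^sup>2 * q)) + c) / D T * \<omega>" for T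
  proof -
    have "X T \<bullet> (T *\<^sub>R y + w) = T * (N + a * s / (1 + T\<^sup>2 * q)) + c"
      by (simp add: inner_add_right inner_commute[of "X T"] wX yX)
    moreover have "w \<bullet> (P' T *v (T *\<^sub>R y + w)) = \<omega>"
      by (simp add: Pd inner_add_right wp \<omega>_def)
    ultimately show ?thesis
      by (simp only: rls_correct_def D inner_diff_right inner_scaleR_right wX)
  qed
  \<comment> \<open>\<open>D T\<close> tends to 2 + \<omega>, so the expression behaves like - T N
    \<omega> / (2 + \<omega>).\<close>
  moreover have "LIM T at_top. c - (T * (N + a * s / (1 + T\<^sup>2 * q)) + c) / D T * \<omega> :> at_bot"
  proof -
    have "((\<lambda>T. 1 / (1 + T\<^sup>2 * q)) \<longlongrightarrow> 0) at_top"
      using pos(1) by real_asymp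
    then have "((\<lambda>T. N + (a * s) * (1 / (1 + T\<^sup>2 * q))) \<longlongrightarrow> N + (a * s) * 0) at_top"
      by (intro tendsto_add tendsto_mult tendsto_const)
    then have "LIM T at_top. c + (N + (a * s) * (1 / (1 + T\<^sup>2 * q))) * T :> at_top"
      using pos(3) by (intro filterlim_tendsto_add_at_top[OF tendsto_const]
          filterlim_tendsto_pos_mult_at_top[OF _ _ filterlim_ident]) auto
    moreover have "((\<lambda>T. T\<^sup>2 * q / (1 + T\<^sup>2 * q)) \<longlongrightarrow> 1) at_top"
      using pos(1) by real_asymp
    then have "((\<lambda>T. - \<omega> / D T) \<longlongrightarrow> - \<omega> / (1 + (1 + \<omega>))) at_top"
      unfolding D_def using pos(2) by (intro tendsto_divide tendsto_add tendsto_const) auto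
    ultimately have "LIM T at_top. (- \<omega> / D T) * (c + (N + (a * s) * (1 / (1 + T\<^sup>2 * q))) * T) :> at_bot"
      using pos(2) by (intro filterlim_tendsto_neg_mult_at_bot[of _ "- \<omega> / (1 + (1 + \<omega>))"]) auto
    then have "LIM T at_top. c + (- \<omega> / D T) * (c + (N + (a * s) * (1 / (1 + T\<^sup>2 * q))) * T) :> at_bot"
      by (rule filterlim_tendsto_add_at_bot_iff[OF tendsto_const, THEN iffD2])
    then show ?thesis
      by (simp add: algebra_simps add_divide_distrib)
  qed
  ultimately show ?thesis
    unfolding X_def by simp
qed

section \<open>The error of the noise-free run\<close>

lemma rls_P_cong:
  assumes "\<And>j. j < k \<Longrightarrow> \<phi> j = \<phi>' j"
  shows "rls_P \<phi> k = rls_P \<phi>' k"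
  using assms by (simp add: fun_eq_iff rls_P_def)

lemma information_cong:
  assumes "\<And>j. j < k \<Longrightarrow> \<phi> j = \<phi>' j"
  shows "information \<phi> k = information \<phi>' k"
  using assms by (simp add: fun_eq_iff information_def)

lemma information_mono:
  assumes "k \<le> k'"
  shows "v \<bullet> (information \<phi> k i *v v) \<le> v \<bullet> (information \<phi> k' i *v v)"
  unfolding information_form using assms by (intro add_left_mono sum_mono2) auto

text \<open>\<open>out_edge\<close> is the form in which irreducibility enters: every node j passes
  its error on to some other node i.\<close>

locale noise_free_run =
  fixes A :: "real^'n^'n" and \<theta> :: "real^'m" and t\<^sub>0 :: "'n \<Rightarrow> real^'m"
  assumes out_edge: "\<And>j. \<exists>i. i \<noteq> j \<and> A $ i $ j > 0"
    and dim_gt_1: "CARD('m) > 1"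
begin

definition err :: "(nat \<Rightarrow> 'n \<Rightarrow> real^'m) \<Rightarrow> nat \<Rightarrow> 'n \<Rightarrow> real^'m" where
  "err \<phi> k i = diffusion_rls A \<phi> (\<lambda>k i. \<theta> \<bullet> \<phi> k i) t\<^sub>0 k i - \<theta>"

text \<open>
  The summand \<open>\<theta>\<close> does not cancel because \<open>A\<close> need not be row stochastic.
\<close>

definition mix :: "('n \<Rightarrow> real^'m) \<Rightarrow> 'n \<Rightarrow> real^'m" where
  "mix z i = (\<Sum>j\<in>UNIV. A $ i $ j *\<^sub>R (\<theta> + z j)) - \<theta>"

lemma mix_upd: "mix (z(j := v)) i = mix (z(j := 0)) i + A $ i $ j *\<^sub>R v"
  by (simp add: mix_def sum.remove[of UNIV j] algebra_simps)

lemma mix_upd_eq_iff: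
  "A $ i $ j \<noteq> 0 \<Longrightarrow> mix (z(j := u)) i = mix (z(j := v)) i \<longleftrightarrow> u = v"
  by (simp add: mix_upd[of z j u] mix_upd[of z j v])

lemma tendsto_mix:
  "(\<And>r. ((\<lambda>x. Z x r) \<longlongrightarrow> z r) F) \<Longrightarrow> ((\<lambda>x. mix (Z x) i) \<longlongrightarrow> mix z i) F"
  unfolding mix_def by (intro tendsto_intros)

lemma err_Suc:
  "err \<phi> (Suc k) i = mix (\<lambda>j. rls_correct (rls_P \<phi> k j) (\<phi> k j) (err \<phi> k j)) i"
proof -
  have "rls_adapt \<phi> (\<lambda>k i. \<theta> \<bullet> \<phi> k i) k j (\<theta> + e) = \<theta> + rls_correct (rls_P \<phi> k j) (\<phi> k j) e"
    for j e
    by (simp add: rls_adapt_def rls_correct_def rls_gain_eq inner_add_left)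
  from this[of _ "err \<phi> k _"] show ?thesis
    by (simp add: mix_def err_def)
qed

text \<open>Causality: only data before time k matter, so a later stage may choose the data from
  time k on freely.\<close>

lemma err_cong:
  assumes "\<And>j. j < k \<Longrightarrow> \<phi> j = \<phi>' j"
  shows "err \<phi> k = err \<phi>' k"
  using assms
proof (induction k)
  case (Suc k)
  then have "rls_P \<phi> k = rls_P \<phi>' k"
    by (intro rls_P_cong) auto
  then show ?case
    using Suc by (simp add: err_Suc fun_eq_iff)
qed (simp add: err_def fun_eq_iff)

definition next_err :: "(nat \<Rightarrow> 'n \<Rightarrow> real^'m) \<Rightarrow> nat \<Rightarrow> ('n \<Rightarrow> real^'m) \<Rightarrow> 'n \<Rightarrow> real^'m" where
  "next_err \<phi> k \<psi> i = mix (\<lambda>j. rls_correct (rls_P \<phi> k j) (\<psi> j) (err \<phi> k j)) i"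

lemma err_fun_upd: "err (\<phi>(k := \<psi>)) (Suc k) = next_err \<phi> k \<psi>"
proof -
  have "rls_P (\<phi>(k := \<psi>)) k = rls_P \<phi> k" "err (\<phi>(k := \<psi>)) k = err \<phi> k"
    by (intro rls_P_cong err_cong; simp)+
  then show ?thesis
    by (simp add: fun_eq_iff err_Suc next_err_def)
qed

lemma next_err_fun_upd:
  "next_err \<phi> k (\<psi>(l := f)) =
    mix ((\<lambda>j. rls_correct (rls_P \<phi> k j) (\<psi> j) (err \<phi> k j))(l := rls_correct (rls_P \<phi> k l) f (err \<phi> k l)))"
proof (rule ext)
  fix i
  have "(\<lambda>j. rls_correct (rls_P \<phi> k j) ((\<psi>(l := f)) j) (err \<phi> k j))
      = (\<lambda>j. rls_correct (rls_P \<phi> k j) (\<psi> j) (err \<phi> k j))(l := rls_correct (rls_P \<phi> k l) f (err \<phi> k l))"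
    by auto
  then show "next_err \<phi> k (\<psi>(l := f)) i = mix (\<dots>) i"
    by (simp only: next_err_def)
qed

text \<open>The invariant of the stages: \<open>rls_correct\<close> can change a nonzero error
  through the regressor, whereas it maps zero to zero.\<close>

definition alive :: "(nat \<Rightarrow> 'n \<Rightarrow> real^'m) \<Rightarrow> nat \<Rightarrow> bool" where
  "alive \<phi> k \<longleftrightarrow> (\<exists>l. err \<phi> k l \<noteq> 0)"

text \<open>Only the regressor of l deviates from g. Two different corrected errors at l give
  different next errors at a receiver i, so one of these is nonzero.\<close>

lemma alive_step:
  assumes "alive \<phi> k"
  shows "\<exists>\<psi>. (\<forall>i. norm (\<psi> i - g i) \<le> 1) \<and> alive (\<phi>(k := \<psi>)) (Suc k)"
proof -
  obtain l where l: "err \<phi> k l \<noteq> 0"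
    using assms by (auto simp: alive_def)
  obtain i where i: "A $ i $ l > 0"
    using out_edge by blast
  obtain f f' where f: "norm (f - g l) \<le> 1" "norm (f' - g l) \<le> 1"
    "rls_correct (rls_P \<phi> k l) f (err \<phi> k l) \<noteq> rls_correct (rls_P \<phi> k l) f' (err \<phi> k l)"
    using rls_correct_nonconstant[where P = "rls_P \<phi> k l" and g = "g l", OF spd_rls_P l] by blast
  then have "next_err \<phi> k (g(l := f)) i \<noteq> next_err \<phi> k (g(l := f')) i"
    using i by (simp add: next_err_fun_upd mix_upd_eq_iff)
  then have "next_err \<phi> k (g(l := f)) i \<noteq> 0 \<or> next_err \<phi> k (g(l := f')) i \<noteq> 0"
    by auto
  then obtain h where "norm (h - g l) \<le> 1" "next_err \<phi> k (g(l := h)) i \<noteq> 0"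
    using f by blast
  then show ?thesis
    by (intro exI[of _ "g(l := h)"]) (auto simp: alive_def err_fun_upd)
qed

text \<open>Node j gets the two regressors of \<open>rls_correct_blow_up\<close> with free parameter
  T. At a receiver i its contribution diverges as T grows, while all others converge.\<close>

lemma err_blow_up:
  assumes "alive \<phi> k"
  shows "\<exists>\<phi>'. (\<forall>j<k. \<phi>' j = \<phi> j) \<and> (\<exists>i. norm (err \<phi>' (Suc (Suc k)) i) > c)"
proof -
  obtain l where l: "err \<phi> k l \<noteq> 0"
    using assms by (auto simp: alive_def)
  \<comment> \<open>The influence goes from l to j and then from j to i; i may coincide with
    l.\<close>
  obtain j where j: "j \<noteq> l" "A $ j $ l > 0"
    using out_edge by blast
  obtain i where i: "i \<noteq> j" "A $ i $ j > 0"
    using out_edge by blast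
  define P where "P = rls_P \<phi> k j"
  define x where "x = err \<phi> k j"
  \<comment> \<open>A zero regressor leaves the error unchanged, so \<open>z f\<close> lists the
    corrected errors when only l is fed. The entry of j is overwritten below.\<close>
  define z where "z f = (err \<phi> k)(l := rls_correct (rls_P \<phi> k l) f (err \<phi> k l))" for f
  have "\<exists>f. mix ((z f)(j := 0)) j \<noteq> 0"
  proof -
    obtain f f' where "rls_correct (rls_P \<phi> k l) f (err \<phi> k l) \<noteq> rls_correct (rls_P \<phi> k l) f' (err \<phi> k l)"
      using rls_correct_nonconstant[where P = "rls_P \<phi> k l" and g = 0, OF spd_rls_P l] by blast
    then have "mix ((z f)(j := 0)) j \<noteq> mix ((z f')(j := 0)) j"
      using j by (simp add: z_def fun_upd_twist[of l j] mix_upd_eq_iff)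
    then show ?thesis by metis
  qed
  then obtain f where "mix ((z f)(j := 0)) j \<noteq> 0" ..
  \<comment> \<open>This part of the next error of j does not depend on the regressor of j at time
    k, so T y can already serve as that regressor.\<close>
  define y where "y = mix ((z f)(j := 0)) j"
  have y: "y \<noteq> 0"
    unfolding y_def by fact
  obtain w where w: "w \<noteq> 0" "orthogonal (P *v y) w"
    using orthogonal_to_vector_exists[of "P *v y"] dim_gt_1 by auto
  then have wP: "w \<bullet> (P *v y) = 0"
    by (simp add: orthogonal_def inner_commute)
  have P: "spd P"
    by (simp add: P_def spd_rls_P)
  define \<psi> where "\<psi> T = (\<lambda>_. 0)(l := f, j := T *\<^sub>R y)" for T :: real
  define \<psi>' where "\<psi>' T = (\<lambda>_. 0)(j := T *\<^sub>R y + w)" for T :: real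
  define \<phi>1 where "\<phi>1 T = \<phi>(k := \<psi> T)" for T
  define \<phi>2 where "\<phi>2 T = (\<phi>1 T)(Suc k := \<psi>' T)" for T
  define X where "X T = rls_correct P (T *\<^sub>R y) x" for T
  have err1: "err (\<phi>1 T) (Suc k) = mix ((z f)(j := X T))" for T
  proof -
    have "(\<lambda>j. rls_correct (rls_P \<phi> k j) (\<psi> T j) (err \<phi> k j)) = (z f)(j := X T)"
      using j by (auto simp: fun_eq_iff \<psi>_def z_def X_def P_def x_def rls_correct_def)
    then show ?thesis
      by (intro ext) (simp only: \<phi>1_def err_fun_upd next_err_def)
  qed
  define P' where "P' T = rls_P (\<phi>1 T) (Suc k) j" for T
  have P': "P' T *v u = P *v u -
      (((T *\<^sub>R y) \<bullet> (P *v u)) / (1 + (T *\<^sub>R y) \<bullet> (P *v (T *\<^sub>R y)))) *\<^sub>R (P *v (T *\<^sub>R y))" for T u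
  proof -
    have "rls_P (\<phi>1 T) k = rls_P \<phi> k"
      by (rule rls_P_cong) (simp add: \<phi>1_def)
    then show ?thesis
      by (simp only: P'_def rls_P_Suc_Sherman_Morrison) (simp add: \<phi>1_def \<psi>_def P_def)
  qed
  have mixX: "mix ((z f)(j := X T)) r = mix ((z f)(j := 0)) r + A $ r $ j *\<^sub>R X T" for r T
    by (rule mix_upd)
  define V where "V T = rls_correct (P' T) (T *\<^sub>R y + w) (y + A $ j $ j *\<^sub>R X T)" for T
  have err2: "err (\<phi>2 T) (Suc (Suc k)) i
      = mix ((mix ((z f)(j := X T)))(j := 0)) i + A $ i $ j *\<^sub>R V T" for T
  proof -
    have "(\<lambda>r. rls_correct (rls_P (\<phi>1 T) (Suc k) r) (\<psi>' T r) (err (\<phi>1 T) (Suc k) r))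
        = (mix ((z f)(j := X T)))(j := V T)"
      by (auto simp: fun_eq_iff \<psi>'_def V_def err1 rls_correct_def P'_def mixX y_def)
    then have "err (\<phi>2 T) (Suc (Suc k)) i = mix ((mix ((z f)(j := X T)))(j := V T)) i"
      by (simp add: \<phi>2_def err_fun_upd next_err_def)
    then show ?thesis
      by (simp add: mix_upd[of _ j "V T"])
  qed
  obtain X0 where X0: "(X \<longlongrightarrow> X0) at_top"
    using rls_correct_tendsto[OF P y] unfolding X_def by blast
  \<comment> \<open>The error of i at the second step without the contribution of j; it converges
    because \<open>X\<close> does.\<close>
  define W where "W T = mix ((mix ((z f)(j := X T)))(j := 0)) i" for T
  define L where "L = mix (\<lambda>r. if r = j then 0 else mix ((z f)(j := 0)) r + A $ r $ j *\<^sub>R X0) i"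
  have L: "(W \<longlongrightarrow> L) at_top"
    unfolding W_def L_def
  proof (rule tendsto_mix)
    show "((\<lambda>T. ((mix ((z f)(j := X T)))(j := 0)) r)
      \<longlongrightarrow> (if r = j then 0 else mix ((z f)(j := 0)) r + A $ r $ j *\<^sub>R X0)) at_top" for r
      using X0 by (cases "r = j") (auto simp: mixX intro!: tendsto_add tendsto_scaleR)
  qed
  have V: "LIM T at_top. w \<bullet> V T :> at_bot"
    unfolding V_def X_def by (rule rls_correct_blow_up[where P' = P', OF P y w(1) wP]) (rule P')
  have "LIM T at_top. w \<bullet> W T + A $ i $ j * (w \<bullet> V T) :> at_bot"
    by (rule filterlim_tendsto_add_at_bot_iff[OF tendsto_inner[OF tendsto_const L], THEN iffD2])
      (rule filterlim_tendsto_pos_mult_at_bot[OF tendsto_const i(2) V])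
  then have "\<forall>\<^sub>F T in at_top. w \<bullet> W T + A $ i $ j * (w \<bullet> V T) < - (norm w * c)"
    by (simp add: filterlim_at_bot_dense)
  then obtain T where "w \<bullet> W T + A $ i $ j * (w \<bullet> V T) < - (norm w * c)"
    by (auto simp: eventually_at_top_linorder)
  then have "norm w * c < - (w \<bullet> err (\<phi>2 T) (Suc (Suc k)) i)"
    by (simp add: err2 inner_add_right flip: W_def)
  also have "\<dots> \<le> norm w * norm (err (\<phi>2 T) (Suc (Suc k)) i)"
    using Cauchy_Schwarz_ineq2[of w "err (\<phi>2 T) (Suc (Suc k)) i"] by linarith
  finally have "c < norm (err (\<phi>2 T) (Suc (Suc k)) i)"
    using w by simp
  moreover have "\<forall>r<k. \<phi>2 T r = \<phi> r"
    by (simp add: \<phi>2_def \<phi>1_def)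
  ultimately show ?thesis by blast
qed

section \<open>Excitation, stages and gluing\<close>

text \<open>One step per basis vector: a regressor within distance 1 of c times the vector of index
  b adds at least c^2 / 2 times the square of \<open>v $ b\<close>, minus
  \<open>v \<bullet> v\<close>, to the quadratic form.\<close>

lemma information_growth:
  fixes c :: real
  assumes "finite B" and "alive \<phi> k"
  shows "\<exists>\<phi>' k'. k \<le> k' \<and> (\<forall>j<k. \<phi>' j = \<phi> j) \<and> alive \<phi>' k' \<and>
    (\<forall>i v. (\<Sum>b\<in>B. c\<^sup>2 / 2 * (v $ b)\<^sup>2 - v \<bullet> v) \<le> v \<bullet> (information \<phi>' k' i *v v))"
  using assms(1)
proof (induction B)
  case empty
  show ?case
    using assms(2) spd_nonneg[OF spd_information] by (intro exI[of _ \<phi>] exI[of _ k]) auto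
next
  case (insert b B)
  then obtain \<phi>' k' where IH: "k \<le> k'" "\<forall>j<k. \<phi>' j = \<phi> j" "alive \<phi>' k'"
    "\<And>i v. (\<Sum>b\<in>B. c\<^sup>2 / 2 * (v $ b)\<^sup>2 - v \<bullet> v) \<le> v \<bullet> (information \<phi>' k' i *v v)"
    by blast
  obtain \<psi> where \<psi>: "\<And>i. norm (\<psi> i - c *\<^sub>R axis b 1) \<le> 1" "alive (\<phi>'(k' := \<psi>)) (Suc k')"
    using alive_step[OF IH(3), of "\<lambda>_. c *\<^sub>R axis b 1"] by blast
  have "(\<Sum>b\<in>insert b B. c\<^sup>2 / 2 * (v $ b)\<^sup>2 - v \<bullet> v)
      \<le> v \<bullet> (information (\<phi>'(k' := \<psi>)) (Suc k') i *v v)" for i v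
  proof -
    define d where "d = (\<psi> i - c *\<^sub>R axis b 1) \<bullet> v"
    have "\<bar>d\<bar> \<le> norm v"
      unfolding d_def using Cauchy_Schwarz_ineq2[of "\<psi> i - c *\<^sub>R axis b 1" v] \<psi>(1)[of i]
      by (meson mult_left_le_one_le norm_ge_zero order_trans)
    then have d: "d\<^sup>2 \<le> v \<bullet> v"
      by (metis abs_norm_cancel abs_le_square_iff power2_norm_eq_inner)
    have cd: "c * v $ b = \<psi> i \<bullet> v - d"
      by (simp add: d_def inner_diff_left inner_axis')
    have "0 \<le> (\<psi> i \<bullet> v + d)\<^sup>2" by simp
    then have "(c * v $ b)\<^sup>2 \<le> 2 * (\<psi> i \<bullet> v)\<^sup>2 + 2 * d\<^sup>2"
      unfolding cd by (simp add: power2_eq_square algebra_simps)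
    then have "c\<^sup>2 / 2 * (v $ b)\<^sup>2 - v \<bullet> v \<le> (\<psi> i \<bullet> v)\<^sup>2"
      using d by (simp add: power_mult_distrib)
    moreover have "v \<bullet> (information (\<phi>'(k' := \<psi>)) (Suc k') i *v v)
        = v \<bullet> (information \<phi>' k' i *v v) + (\<psi> i \<bullet> v)\<^sup>2"
      by (simp add: information_form)
    ultimately show ?thesis
      using insert IH(4)[of v i] by simp
  qed
  then show ?case
    using IH(1,2) \<psi>(2) by (intro exI[of _ "\<phi>'(k' := \<psi>)"] exI[of _ "Suc k'"] conjI) (simp_all del: fun_upd_apply, simp)
qed

text \<open>Excitation comes first and blow-up last: information never decreases, so it survives the
  two blow-up steps, and the error is large at the end.\<close>

lemma extend_data:
  assumes "alive \<phi> k"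
  shows "\<exists>\<phi>' k'. k < k' \<and> (\<forall>j<k. \<phi>' j = \<phi> j) \<and> (\<exists>i. norm (err \<phi>' k' i) > real s) \<and>
    (\<forall>i v. real s * (v \<bullet> v) \<le> v \<bullet> (information \<phi>' k' i *v v))"
proof -
  define m where "m = real CARD('m)"
  \<comment> \<open>Summing over the basis gives the factor c^2 / 2 - m. Here c^2 / 2 = 2 (s + m)^2,
    which is at least s + m because m >= 1.\<close>
  define c where "c = 2 * (s + m)"
  have "m \<ge> 1"
    using dim_gt_1 by (simp add: m_def)
  then have "(s + m) * 1 \<le> (s + m) * (s + m)"
    by (intro mult_left_mono) auto
  also have "2 * ((s + m) * (s + m)) = c\<^sup>2 / 2"
    by (simp add: c_def power2_eq_square algebra_simps)
  finally have c: "s \<le> c\<^sup>2 / 2 - m"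
    using \<open>m \<ge> 1\<close> by simp
  obtain \<phi>1 k1 where 1: "k \<le> k1" "\<forall>j<k. \<phi>1 j = \<phi> j" "alive \<phi>1 k1"
    "\<And>i v. (\<Sum>b\<in>UNIV. c\<^sup>2 / 2 * (v $ b)\<^sup>2 - v \<bullet> v) \<le> v \<bullet> (information \<phi>1 k1 i *v v)"
    using information_growth[of UNIV \<phi> k c] assms by auto
  obtain \<phi>2 where 2: "\<forall>j<k1. \<phi>2 j = \<phi>1 j" "\<exists>i. norm (err \<phi>2 (Suc (Suc k1)) i) > s"
    using err_blow_up[OF 1(3)] by blast
  have "s * (v \<bullet> v) \<le> v \<bullet> (information \<phi>2 (Suc (Suc k1)) i *v v)" for i v
  proof -
    have "s * (v \<bullet> v) \<le> (c\<^sup>2 / 2 - m) * (v \<bullet> v)"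
      using c by (intro mult_right_mono) auto
    also have "\<dots> = (\<Sum>b\<in>UNIV. c\<^sup>2 / 2 * (v $ b)\<^sup>2 - v \<bullet> v)"
      by (simp add: sum_subtractf left_diff_distrib m_def inner_vec_def sum_distrib_left
          power2_eq_square)
    also have "\<dots> \<le> v \<bullet> (information \<phi>1 k1 i *v v)"
      by (rule 1)
    also have "information \<phi>1 k1 = information \<phi>2 k1"
      using 2 by (intro information_cong) auto
    also have "v \<bullet> (information \<phi>2 k1 i *v v) \<le> v \<bullet> (information \<phi>2 (Suc (Suc k1)) i *v v)"
      by (rule information_mono) simp
    finally show ?thesis .
  qed
  then show ?thesis
    using 1 2 by (intro exI[of _ \<phi>2] exI[of _ "Suc (Suc k1)"]) auto
qed

lemma divergent_data:
  assumes "\<exists>i. t\<^sub>0 i \<noteq> \<theta>"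
  shows "\<exists>\<phi>. (\<forall>s. \<exists>k i. norm (err \<phi> k i) > real s) \<and>
    (\<forall>s. \<exists>k. \<forall>i v. real s * (v \<bullet> v) \<le> v \<bullet> (information \<phi> k i *v v))"
proof -
  define good where "good s \<phi> k \<longleftrightarrow> (\<exists>i. norm (err \<phi> k i) > real s) \<and>
    (\<forall>i v. real s * (v \<bullet> v) \<le> v \<bullet> (information \<phi> k i *v v))" for s \<phi> k
  have good_alive: "good s \<phi> k \<Longrightarrow> alive \<phi> k" for s \<phi> k
    unfolding good_def alive_def by (metis norm_zero not_less of_nat_0_le_iff)
  \<comment> \<open>A state consists of data and the time before which they are frozen. Stage 0 only
    has to be alive.\<close>
  have "\<exists>f. \<forall>n. (case f n of (\<phi>, k) \<Rightarrow> alive \<phi> k \<and> (0 < n \<longrightarrow> good n \<phi> k)) \<and>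
      (case f n of (\<phi>, k) \<Rightarrow> case f (Suc n) of (\<phi>', k') \<Rightarrow> k < k' \<and> (\<forall>j<k. \<phi>' j = \<phi> j))"
  proof (rule dependent_nat_choice, goal_cases)
    case 1
    show ?case
      using assms by (intro exI[of _ "(\<lambda>_ _. 0, 0)"]) (simp add: alive_def err_def)
  next
    case (2 x n)
    then obtain \<phi> k where x: "x = (\<phi>, k)" "alive \<phi> k"
      by (cases x) auto
    from extend_data[OF x(2), of "Suc n"] obtain \<phi>' k'
      where "k < k'" "\<forall>j<k. \<phi>' j = \<phi> j" "good (Suc n) \<phi>' k'"
      unfolding good_def by blast
    then show ?case
      using x good_alive by (intro exI[of _ "(\<phi>', k')"]) auto
  qed
  then obtain f where f: "\<And>n. (case f n of (\<phi>, k) \<Rightarrow> alive \<phi> k \<and> (0 < n \<longrightarrow> good n \<phi> k)) \<and>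
      (case f n of (\<phi>, k) \<Rightarrow> case f (Suc n) of (\<phi>', k') \<Rightarrow> k < k' \<and> (\<forall>j<k. \<phi>' j = \<phi> j))"
    by blast
  define F where "F n = fst (f n)" for n
  define K where "K n = snd (f n)" for n
  have good: "0 < n \<Longrightarrow> good n (F n) (K n)" and K: "K n < K (Suc n)"
    and F: "j < K n \<Longrightarrow> F (Suc n) j = F n j" for n j
    using f[of n] by (auto simp: F_def K_def split: prod.splits)
  have Kmono: "strict_mono K"
    using K by (simp add: strict_mono_Suc_iff)
  have agree: "j < K n \<Longrightarrow> F (n + d) j = F n j" for n d j
  proof (induction d)
    case (Suc d)
    have "K n \<le> K (n + d)"
      using Kmono by (simp add: strict_mono_less_eq)
    then show ?case
      using Suc F[of j "n + d"] by simp
  qed simp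
  \<comment> \<open>Since \<open>K (Suc j)\<close> is at least \<open>Suc j\<close>, entry j is
    frozen from stage \<open>Suc j\<close> on.\<close>
  define \<phi> where "\<phi> j = F (Suc j) j" for j
  have \<phi>: "j < K n \<Longrightarrow> \<phi> j = F n j" for j n
  proof -
    assume j: "j < K n"
    have "Suc j \<le> K (Suc j)"
      using Kmono strict_mono_imp_increasing by blast
    then show "\<phi> j = F n j"
      using agree[of j n "Suc j - n"] agree[of j "Suc j" "n - Suc j"] j
      by (cases "n \<le> Suc j") (auto simp: \<phi>_def)
  qed
  have good\<phi>: "good s \<phi> (K s)" if "0 < s" for s
  proof -
    have "err \<phi> (K s) = err (F s) (K s)" "information \<phi> (K s) = information (F s) (K s)"
      by (intro err_cong information_cong \<phi>; simp)+
    then show ?thesis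
      using good[OF that] by (simp add: good_def)
  qed
  show ?thesis
  proof (intro exI[of _ \<phi>] conjI allI)
    fix s
    \<comment> \<open>\<open>Suc s\<close> avoids stage 0, for which \<open>good\<close> is not
      guaranteed.\<close>
    have "good (Suc s) \<phi> (K (Suc s))"
      by (rule good\<phi>) simp
    then show "\<exists>k i. norm (err \<phi> k i) > real s"
      unfolding good_def by (metis lessI less_trans of_nat_less_iff)
    have "real s * (v \<bullet> v) \<le> real (Suc s) * (v \<bullet> v)" for v :: "real^'m"
      by (intro mult_right_mono) auto
    then show "\<exists>k. \<forall>i v. real s * (v \<bullet> v) \<le> v \<bullet> (information \<phi> k i *v v)"
      using \<open>good (Suc s) \<phi> (K (Suc s))\<close> unfolding good_def by (meson order_trans)
  qed
qed

end

section \<open>Irreducibility, expectations and the conclusion\<close>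

text \<open>If column j vanished off the diagonal, an enumeration starting with j would exhibit a
  zero lower left block with r = 1.\<close>

lemma irreducible_out_edge:
  fixes A :: "real^'n^'n"
  assumes "weighted_adjacency E A" and "irreducible_matrix A" and n: "CARD('n) > 1"
  shows "\<exists>i. i \<noteq> j \<and> A $ i $ j > 0"
proof (rule ccontr)
  assume none: "\<not> ?thesis"
  have zero: "A $ i $ j = 0" if "i \<noteq> j" for i
  proof (cases "(i, j) \<in> E")
    case True
    then show ?thesis
      using assms(1) none that unfolding weighted_adjacency_def by metis
  next
    case False
    then show ?thesis
      using assms(1) unfolding weighted_adjacency_def by metis
  qed
  obtain h where h: "bij_betw h {0..<CARD('n)} (UNIV :: 'n set)"
    using ex_bij_betw_nat_finite[of "UNIV :: 'n set"] by auto
  define \<pi> where "\<pi> = Transposition.transpose (h 0) j \<circ> h"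
  have \<pi>: "bij_betw \<pi> {..<CARD('n)} UNIV"
    unfolding \<pi>_def using h by (intro bij_betw_trans[of h _ UNIV]) (auto simp: atLeast0LessThan)
  have "\<pi> 0 = j"
    by (simp add: \<pi>_def)
  moreover have "\<pi> i \<noteq> \<pi> 0" if "i \<in> {1..<CARD('n)}" for i
    using that inj_onD[OF bij_betw_imp_inj_on[OF \<pi>], of i 0] by auto
  ultimately have "\<forall>i\<in>{1..<CARD('n)}. \<forall>l\<in>{..<1}. A $ \<pi> i $ \<pi> l = 0"
    using zero by auto
  then have "reducible_matrix A"
    unfolding reducible_matrix_def using \<pi> n by (intro exI[of _ \<pi>] exI[of _ 1]) auto
  then show False
    using assms(2) by simp
qed

text \<open>The quadratic form grows with time, so a bound reached at one time k persists.\<close>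

lemma filterlim_lambda_min:
  assumes "\<And>s. \<exists>k. \<forall>v. real s * (v \<bullet> v) \<le> v \<bullet> (information \<phi> k i *v v)"
  shows "filterlim (\<lambda>k. lambda_min (matrix_inv (rls_P \<phi> k i))) at_top sequentially"
  unfolding filterlim_at_top
proof
  fix Z :: real
  obtain s :: nat where s: "Z \<le> real s"
    using real_arch_simple by blast
  obtain k where k: "\<And>v. real s * (v \<bullet> v) \<le> v \<bullet> (information \<phi> k i *v v)"
    using assms by blast
  have "Z \<le> lambda_min (matrix_inv (rls_P \<phi> k' i))" if "k \<le> k'" for k'
  proof -
    have "real s \<le> lambda_min (information \<phi> k' i)"
      by (intro lambda_min_ge self_adjoint_information order_trans[OF k information_mono[OF that]])
    then show ?thesis
      using s by (simp add: rls_P_eq matrix_inv_matrix_inv_spd spd_information)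
  qed
  then show "\<forall>\<^sub>F k in sequentially. Z \<le> lambda_min (matrix_inv (rls_P \<phi> k i))"
    by (auto simp: eventually_sequentially)
qed

text \<open>With deterministic data each step is affine in the estimates and the noise, so
  expectation passes through it and the centred noise disappears. Integrability is carried in the
  same induction to justify this.\<close>

lemma
  fixes \<theta> :: "real^'m" and \<theta>\<^sub>0 :: "'n::finite \<Rightarrow> 'w \<Rightarrow> real^'m" and \<epsilon> :: "nat \<Rightarrow> 'w \<Rightarrow> real^'n"
    and A :: "real^'n^'n"
  assumes "prob_space \<Omega>"
    and \<epsilon>: "\<And>i k. integrable \<Omega> (\<lambda>\<omega>. \<epsilon> k \<omega> $ i)" "\<And>i k. (\<integral>\<omega>. \<epsilon> k \<omega> $ i \<partial>\<Omega>) = 0"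
    and \<theta>\<^sub>0: "\<And>i. integrable \<Omega> (\<theta>\<^sub>0 i)"
  defines "run \<equiv> \<lambda>\<phi> k i \<omega>. diffusion_rls A \<phi> (observation \<theta> \<phi> \<epsilon> \<omega>) (\<lambda>i. \<theta>\<^sub>0 i \<omega>) k i"
  shows integrable_diffusion_rls: "integrable \<Omega> (run \<phi> k i)"
    and integral_diffusion_rls: "(\<integral>\<omega>. run \<phi> k i \<omega> \<partial>\<Omega>)
      = diffusion_rls A \<phi> (\<lambda>k i. \<theta> \<bullet> \<phi> k i) (\<lambda>i. \<integral>\<omega>. \<theta>\<^sub>0 i \<omega> \<partial>\<Omega>) k i" (is "_ = ?mean k i")
proof -
  interpret prob_space \<Omega> by fact
  have "integrable \<Omega> (run \<phi> k i) \<and> (\<integral>\<omega>. run \<phi> k i \<omega> \<partial>\<Omega>) = ?mean k i"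
  proof (induction k arbitrary: i)
    case 0
    then show ?case
      using \<theta>\<^sub>0 by (simp add: run_def)
  next
    case (Suc k)
    define g where "g j \<omega> = run \<phi> k j \<omega>
      + (\<theta> \<bullet> \<phi> k j + \<epsilon> k \<omega> $ j - run \<phi> k j \<omega> \<bullet> \<phi> k j) *\<^sub>R rls_gain \<phi> k j" for j \<omega>
    have I: "integrable \<Omega> (run \<phi> k j)" "(\<integral>\<omega>. run \<phi> k j \<omega> \<partial>\<Omega>) = ?mean k j" for j
      using Suc by auto
    have g: "integrable \<Omega> (g j)"
      "(\<integral>\<omega>. g j \<omega> \<partial>\<Omega>) = rls_adapt \<phi> (\<lambda>k i. \<theta> \<bullet> \<phi> k i) k j (?mean k j)" for j
      unfolding g_def rls_adapt_def using I(1)[of j] \<epsilon>[of k j]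
      by (simp_all add: I(2) prob_space)
    have "run \<phi> (Suc k) i = (\<lambda>\<omega>. \<Sum>j\<in>UNIV. A $ i $ j *\<^sub>R g j \<omega>)"
      by (simp add: run_def g_def rls_adapt_def observation_def fun_eq_iff)
    then show ?case
      using g by simp
  qed
  then show "integrable \<Omega> (run \<phi> k i)" "(\<integral>\<omega>. run \<phi> k i \<omega> \<partial>\<Omega>) = ?mean k i"
    by auto
qed

text \<open>Uses r <= 1 + r^2. The nonnegative integral also covers an infinite second
  moment.\<close>

lemma (in prob_space) nn_integral_norm_square_ge:
  fixes X :: "'a \<Rightarrow> real^'m^'n"
  assumes "integrable M (\<lambda>\<omega>. X \<omega> $ i)"
    and [measurable]: "(\<lambda>\<omega>. norm (X \<omega>)) \<in> borel_measurable M"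
  shows "ennreal (norm (\<integral>\<omega>. X \<omega> $ i \<partial>M)) \<le> 1 + (\<integral>\<^sup>+\<omega>. ennreal ((norm (X \<omega>))\<^sup>2) \<partial>M)"
proof -
  have "ennreal (norm (\<integral>\<omega>. X \<omega> $ i \<partial>M)) \<le> (\<integral>\<^sup>+\<omega>. ennreal (norm (X \<omega> $ i)) \<partial>M)"
    by (rule integral_norm_bound_ennreal[OF assms(1)])
  also have "\<dots> \<le> (\<integral>\<^sup>+\<omega>. 1 + ennreal ((norm (X \<omega>))\<^sup>2) \<partial>M)"
  proof (rule nn_integral_mono)
    fix \<omega>
    have "norm (X \<omega> $ i) \<le> norm (X \<omega>)"
      by (rule Finite_Cartesian_Product.norm_nth_le)
    moreover have "2 * norm (X \<omega>) \<le> 1 + (norm (X \<omega>))\<^sup>2"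
      using zero_le_power2[of "norm (X \<omega>) - 1"] by (simp add: power2_diff)
    ultimately have "norm (X \<omega> $ i) \<le> 1 + (norm (X \<omega>))\<^sup>2"
      using norm_ge_zero[of "X \<omega>"] by linarith
    then show "ennreal (norm (X \<omega> $ i)) \<le> 1 + ennreal ((norm (X \<omega>))\<^sup>2)"
      by (simp flip: ennreal_1 ennreal_plus)
  qed
  also have "\<dots> = 1 + (\<integral>\<^sup>+\<omega>. ennreal ((norm (X \<omega>))\<^sup>2) \<partial>M)"
    by (subst nn_integral_add) (auto simp: emeasure_space_1)
  finally show ?thesis .
qed

theorem theorem2p3:
  fixes \<Omega> :: "'w measure"
    and E :: "('n::finite \<times> 'n) set"
    and A :: "real^'n^'n"
    and \<theta> :: "real^'m::finite"
    and \<epsilon> :: "nat \<Rightarrow> 'w \<Rightarrow> real^'n"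
    and \<theta>\<^sub>0 :: "'n \<Rightarrow> 'w \<Rightarrow> real^'m"
    and M :: real
  assumes "prob_space \<Omega>"
    and "CARD('m) > 1"
    and "CARD('n) > 1"
    and "weighted_adjacency E A"
    and "irreducible_matrix A"
    and "prob_space.indep_vars \<Omega> (\<lambda>_. borel) \<epsilon> UNIV"
    and "\<And>i k. integrable \<Omega> (\<lambda>\<omega>. \<epsilon> k \<omega> $ i)"
    and "\<And>i k. (\<integral>\<omega>. \<epsilon> k \<omega> $ i \<partial>\<Omega>) = 0"
    and "M > 0"
    and "\<And>i. (SUP k\<in>{1..}. \<integral>\<^sup>+\<omega>. ennreal ((\<epsilon> k \<omega> $ i)\<^sup>2) \<partial>\<Omega>) < ennreal M"
    and "\<And>i. integrable \<Omega> (\<theta>\<^sub>0 i)"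
    and "norm (\<integral>\<omega>. (\<chi> i. \<theta>\<^sub>0 i \<omega> - \<theta>) \<partial>\<Omega>) \<noteq> 0"
  shows "\<exists>\<phi> :: nat \<Rightarrow> 'n \<Rightarrow> real^'m.
           (\<forall>i. filterlim (\<lambda>k. lambda_min (matrix_inv (rls_P \<phi> k i))) at_top sequentially) \<and>
           (SUP k. \<integral>\<^sup>+\<omega>. ennreal ((norm (estimation_error A \<theta> \<phi> \<epsilon> \<theta>\<^sub>0 k \<omega>))\<^sup>2) \<partial>\<Omega>) = \<infinity>"
proof -
  interpret prob_space \<Omega> by fact
  define t\<^sub>0 where "t\<^sub>0 = (\<lambda>i. \<integral>\<omega>. \<theta>\<^sub>0 i \<omega> \<partial>\<Omega>)"
  interpret noise_free_run A \<theta> t\<^sub>0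
    using irreducible_out_edge[OF assms(4,5,3)] assms(2) by unfold_locales
  have "\<exists>i. t\<^sub>0 i \<noteq> \<theta>"
  proof (rule ccontr)
    assume *: "\<not> ?thesis"
    let ?X = "\<lambda>\<omega>. (\<chi> i. \<theta>\<^sub>0 i \<omega> - \<theta>)"
    \<comment> \<open>The integral of a non-integrable function is 0 by convention, so a nonzero
      mean implies integrability.\<close>
    have "integrable \<Omega> ?X"
      using assms(12) not_integrable_integral_eq by fastforce
    then have "(\<integral>\<omega>. ?X \<omega> \<partial>\<Omega>) $ i = (\<integral>\<omega>. \<theta>\<^sub>0 i \<omega> - \<theta> \<partial>\<Omega>)" for i
      using integral_bounded_linear[OF bounded_linear_vec_nth, of \<Omega> ?X i] by simp
    also have "(\<integral>\<omega>. \<theta>\<^sub>0 i \<omega> - \<theta> \<partial>\<Omega>) = 0" for i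
      using * assms(11)[of i] by (simp add: t\<^sub>0_def prob_space)
    finally have "(\<integral>\<omega>. ?X \<omega> \<partial>\<Omega>) = 0"
      by (simp add: vec_eq_iff)
    then show False
      using assms(12) by simp
  qed
  then obtain \<phi> where \<phi>: "\<And>s. \<exists>k i. norm (err \<phi> k i) > real s"
    "\<And>s. \<exists>k. \<forall>i v. real s * (v \<bullet> v) \<le> v \<bullet> (information \<phi> k i *v v)"
    using divergent_data by blast
  define X where "X = estimation_error A \<theta> \<phi> \<epsilon> \<theta>\<^sub>0"
  have X: "integrable \<Omega> (\<lambda>\<omega>. X k \<omega> $ i)" "(\<integral>\<omega>. X k \<omega> $ i \<partial>\<Omega>) = err \<phi> k i" for k i
    unfolding X_def estimation_error_def err_def
    using integrable_diffusion_rls[where \<epsilon> = \<epsilon> and \<theta>\<^sub>0 = \<theta>\<^sub>0, OF assms(1,7,8,11)]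
      integral_diffusion_rls[where \<epsilon> = \<epsilon> and \<theta>\<^sub>0 = \<theta>\<^sub>0, OF assms(1,7,8,11)]
    by (simp_all add: prob_space t\<^sub>0_def)
  have meas: "(\<lambda>\<omega>. norm (X k \<omega>)) \<in> borel_measurable \<Omega>" for k
  proof -
    have "norm (X k \<omega>) = sqrt (\<Sum>i\<in>UNIV. (norm (X k \<omega> $ i))\<^sup>2)" for \<omega>
      by (rule norm_vec_def[unfolded L2_set_def])
    then show ?thesis
      using borel_measurable_integrable[OF X(1)] by simp
  qed
  have "(SUP k. \<integral>\<^sup>+\<omega>. ennreal ((norm (X k \<omega>))\<^sup>2) \<partial>\<Omega>) = \<infinity>"
    unfolding infinity_ennreal_def
  proof (rule ennreal_SUP_eq_top)
    fix n :: nat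
    \<comment> \<open>\<open>Suc n\<close> absorbs the summand 1 of
      \<open>nn_integral_norm_square_ge\<close>.\<close>
    obtain k i where "norm (err \<phi> k i) > real (Suc n)"
      using \<phi>(1) by blast
    then have "ennreal (1 + real n) \<le> ennreal (norm (\<integral>\<omega>. X k \<omega> $ i \<partial>\<Omega>))"
      unfolding X(2) by (intro ennreal_leI) simp
    also have "\<dots> \<le> 1 + (\<integral>\<^sup>+\<omega>. ennreal ((norm (X k \<omega>))\<^sup>2) \<partial>\<Omega>)"
      by (rule nn_integral_norm_square_ge[OF X(1) meas])
    finally have "of_nat n \<le> (\<integral>\<^sup>+\<omega>. ennreal ((norm (X k \<omega>))\<^sup>2) \<partial>\<Omega>)"
      by (simp add: ennreal_of_nat_eq_real_of_nat)
    then show "\<exists>k\<in>UNIV. of_nat n \<le> (\<integral>\<^sup>+\<omega>. ennreal ((norm (X k \<omega>))\<^sup>2) \<partial>\<Omega>)"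
      by blast
  qed
  moreover have "filterlim (\<lambda>k. lambda_min (matrix_inv (rls_P \<phi> k i))) at_top sequentially" for i
    using \<phi>(2) by (intro filterlim_lambda_min) blast
  ultimately show ?thesis
    unfolding X_def by blast
qed

end
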